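(* Let $\mathcal{C}$ be a completely decomposable $[n,k]_{q^m/q}$ code of type $(n_1,\ldots,n_k)$. Let $G=\mathbf{u}_1\oplus\ldots\oplus\mathbf{u}_k$ be a generator matrix of $\mathcal{C}$ in a weight complementary form and let $U_i$ be the $\mathbb{F}_q$-span of the entries of $\mathbf{u}_i$, for every $i$. For any integer $t\in\{1,\ldots,k-1\}$, the set of codewords of $\Sigma(\mathcal{C},t)\setminus\Sigma(\mathcal{C},t+1)$ of weight $n_t$ is $$\mathcal{W}_t=\left\{\beta(\mathbf{0},\ldots,\mathbf{0},\mathbf{u}_t,\xi_{t+1}\mathbf{u}_{t+1},\ldots,\xi_k\mathbf{u}_k): \xi_h\in\left(U_t^{\perp^*}U_h\right)^{\perp^*}\text{ for } h\in\{t+1,\ldots,k\}\text{ and }\beta\in\mathbb{F}_{q^m}^*\right\}.$$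
   Context: Let $q$ be a prime power. The rank weight (here: weight) of $\mathbf{v}\in\mathbb{F}_{q^m}^n$ is the $\mathbb{F}_q$-dimension $\mathrm{w}(\mathbf{v})$ of the $\mathbb{F}_q$-span of its entries. An $[n,k]_{q^m/q}$ code is a $k$-dimensional $\mathbb{F}_{q^m}$-subspace $\mathcal{C}$ of $\mathbb{F}_{q^m}^n$; a generator matrix is $G\in\mathbb{F}_{q^m}^{k\times n}$ with $\mathcal{C}=\{\mathbf{x}G:\mathbf{x}\in\mathbb{F}_{q^m}^k\}$. Two codes in $\mathbb{F}_{q^m}^n$ are equivalent if one is obtained from the other by right multiplication by some $A\in\mathrm{GL}(n,q)$. For integers $m>n_1\geq\ldots\geq n_k\geq1$, an $[n,k]_{q^m/q}$ code is completely decomposable of type $(n_1,\ldots,n_k)$ if $n=n_1+\ldots+n_k$ and it is equivalent to a code having a block-diagonal generator matrix $\mathbf{u}_1\oplus\ldots\oplus\mathbf{u}_k$ with $\mathbf{u}_i\in\mathbb{F}_{q^m}^{1\times n_i}$ and $\mathrm{w}(\mathbf{u}_i)=n_i$ for each $i$. A generator matrix of this block-diagonal form is said to be in a weight complementary form. If $\mathcal{C}$ has such a generator matrix, for $t\in\{1,\ldots,k\}$ the $t$-shortened code is $\Sigma(\mathcal{C},t)=\{(\alpha_1\mathbf{u}_1,\ldots,\alpha_k\mathbf{u}_k)\in\mathcal{C}:\alpha_i\in\mathbb{F}_{q^m},\ \alpha_i=0\text{ for }i=1,\ldots,t-1\}\subseteq\mathbb{F}_{q^m}^n$. For an $\mathbb{F}_q$-subspace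 $W\subseteq\mathbb{F}_{q^m}$, $W^{\perp^*}=\{b\in\mathbb{F}_{q^m}:\mathrm{Tr}_{q^m/q}(ab)=0\ \forall a\in W\}$, with $\mathrm{Tr}_{q^m/q}$ the trace from $\mathbb{F}_{q^m}$ to $\mathbb{F}_q$. For $\mathbb{F}_q$-subspaces $U,V\subseteq\mathbb{F}_{q^m}$, $UV$ denotes the $\mathbb{F}_q$-span of $\{ab:a\in U,b\in V\}$. *)

theory Defs
  imports "Jordan_Normal_Form.VS_Connect"
begin

text \<open>
  A field extension of degree \<open>m\<close> over the field with \<open>q\<close> elements is given by two field types
  \<open>'f\<close> (with \<open>q\<close> elements) and \<open>'a\<close> (with \<open>q ^ m\<close> elements) and a field embedding \<open>\<iota>\<close>. The
  order \<open>q\<close> of a finite field is automatically a prime power.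
\<close>

locale finite_field_extension = field_hom \<iota>
  for \<iota> :: "'f :: {field, finite} \<Rightarrow> 'a :: {field, finite}" +
  fixes q m :: nat
  assumes card_base: "card (UNIV :: 'f set) = q"
    and card_ext: "card (UNIV :: 'a set) = q ^ m"

definition Fq_span :: "('f :: {field, finite} \<Rightarrow> 'a :: {field, finite}) \<Rightarrow> 'a set \<Rightarrow> 'a set" where
  "Fq_span \<iota> S = Modules.module.span (\<lambda>c x. \<iota> c * x) S"

definition Fq_dim :: "('f :: {field, finite} \<Rightarrow> 'a :: {field, finite}) \<Rightarrow> 'a set \<Rightarrow> nat" where
  "Fq_dim \<iota> V = Vector_Spaces.vector_space.dim (\<lambda>c x. \<iota> c * x) V"

definition rank_weight :: "('f :: {field, finite} \<Rightarrow> 'a :: {field, finite}) \<Rightarrow> 'a vec \<Rightarrow> nat" where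
  "rank_weight \<iota> v = Fq_dim \<iota> (Fq_span \<iota> (set\<^sub>v v))"

text \<open>
  The trace is kept in the extension field; its values lie in the image of the base field.
\<close>

definition field_trace :: "nat \<Rightarrow> nat \<Rightarrow> 'a :: field \<Rightarrow> 'a" where
  "field_trace q m x = (\<Sum>i<m. x ^ (q ^ i))"

definition trace_dual :: "nat \<Rightarrow> nat \<Rightarrow> 'a :: field set \<Rightarrow> 'a set" where
  "trace_dual q m W = {b. \<forall>a\<in>W. field_trace q m (a * b) = 0}"

definition product_space ::
  "('f :: {field, finite} \<Rightarrow> 'a :: {field, finite}) \<Rightarrow> 'a set \<Rightarrow> 'a set \<Rightarrow> 'a set" where
  "product_space \<iota> U V = Fq_span \<iota> {a * b | a b. a \<in> U \<and> b \<in> V}"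

definition linear_code :: "nat \<Rightarrow> nat \<Rightarrow> 'a :: field vec set \<Rightarrow> bool" where
  "linear_code n k C \<longleftrightarrow>
     VectorSpace.subspace class_ring C (module_vec TYPE('a) n) \<and>
     vectorspace.dim class_ring ((module_vec TYPE('a) n)\<lparr>carrier := C\<rparr>) = k"

text \<open>
  Codewords are row vectors, so the product \<open>x G\<close> is written \<open>G\<^sup>T *\<^sub>v x\<close>.
\<close>

definition generator_matrix :: "nat \<Rightarrow> nat \<Rightarrow> 'a :: field vec set \<Rightarrow> 'a mat \<Rightarrow> bool" where
  "generator_matrix n k C G \<longleftrightarrow>
     G \<in> carrier_mat k n \<and> C = {G\<^sup>T *\<^sub>v x | x. x \<in> carrier_vec k}"

definition equivalent_codes ::
  "('f :: {field, finite} \<Rightarrow> 'a :: {field, finite}) \<Rightarrow> nat \<Rightarrow> 'a vec set \<Rightarrow> 'a vec set \<Rightarrow> bool" where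
  "equivalent_codes \<iota> n C D \<longleftrightarrow>
     (\<exists>A \<in> carrier_mat n n. invertible_mat A \<and> D = {(map_mat \<iota> A)\<^sup>T *\<^sub>v c | c. c \<in> C})"

text \<open>
  Blocks are indexed by \<open>1, \<dots>, k\<close>;
  values of \<open>ns\<close>, \<open>u\<close> and \<open>v\<close> at other indices are irrelevant.
\<close>

definition concat_blocks :: "nat \<Rightarrow> (nat \<Rightarrow> 'a vec) \<Rightarrow> 'a vec" where
  "concat_blocks k v = vec_of_list (concat (map (\<lambda>i. list_of_vec (v i)) [1..<Suc k]))"

definition weight_complementary_form ::
  "('f :: {field, finite} \<Rightarrow> 'a :: {field, finite}) \<Rightarrow> nat \<Rightarrow> (nat \<Rightarrow> nat) \<Rightarrow> (nat \<Rightarrow> 'a vec) \<Rightarrow> 'a mat \<Rightarrow> bool"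
  where
  "weight_complementary_form \<iota> k ns u G \<longleftrightarrow>
     (\<forall>i\<in>{1..k}. u i \<in> carrier_vec (ns i) \<and> rank_weight \<iota> (u i) = ns i) \<and>
     G = diag_block_mat (map (\<lambda>i. mat_of_row (u i)) [1..<Suc k])"

definition completely_decomposable ::
  "('f :: {field, finite} \<Rightarrow> 'a :: {field, finite}) \<Rightarrow> nat \<Rightarrow> nat \<Rightarrow> nat \<Rightarrow> (nat \<Rightarrow> nat) \<Rightarrow> 'a vec set \<Rightarrow> bool"
  where
  "completely_decomposable \<iota> m n k ns C \<longleftrightarrow>
     linear_code n k C \<and>
     1 \<le> k \<and> ns 1 < m \<and> antimono_on {1..k} ns \<and> 1 \<le> ns k \<and>
     n = (\<Sum>i=1..k. ns i) \<and>
     (\<exists>D u G. equivalent_codes \<iota> n C D \<and> generator_matrix n k D G \<and>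
              weight_complementary_form \<iota> k ns u G)"

definition shortened_code :: "nat \<Rightarrow> (nat \<Rightarrow> 'a :: field vec) \<Rightarrow> 'a vec set \<Rightarrow> nat \<Rightarrow> 'a vec set" where
  "shortened_code k u C t =
     {c \<in> C. \<exists>\<alpha>. (\<forall>i\<in>{1..<t}. \<alpha> i = 0) \<and> c = concat_blocks k (\<lambda>i. \<alpha> i \<cdot>\<^sub>v u i)}"

end

theory Submission
  imports Defs
begin

text \<open>
  The word \<open>(0, \<dots>, 0, \<alpha>\<^sub>t u\<^sub>t, \<dots>, \<alpha>\<^sub>k u\<^sub>k)\<close> with \<open>\<alpha>\<^sub>t \<noteq> 0\<close> has weight equal to the dimension of
  \<open>\<alpha>\<^sub>t U\<^sub>t + \<dots> + \<alpha>\<^sub>k U\<^sub>k\<close>. This space contains \<open>\<alpha>\<^sub>t U\<^sub>t\<close>, of dimension \<open>n\<^sub>t\<close>, so the weight is \<open>n\<^sub>t\<close>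
  iff \<open>\<xi>\<^sub>h U\<^sub>h \<subseteq> U\<^sub>t\<close> for all \<open>h\<close>, where \<open>\<xi>\<^sub>h = \<alpha>\<^sub>h / \<alpha>\<^sub>t\<close>. Since \<open>U\<^sub>t\<close> is its own double dual for the
  trace form, this says that \<open>\<xi>\<^sub>h\<close> annihilates the product of the dual of \<open>U\<^sub>t\<close> with \<open>U\<^sub>h\<close>.
\<close>

section \<open>Frobenius in finite fields\<close>

text \<open>Multiplication by a nonzero \<open>x\<close> permutes the nonzero elements, so their
  product \<open>?P\<close> picks up a factor \<open>x ^ (?N - 1)\<close>. Cancelling
  \<open>?P\<close> leaves \<open>x ^ (?N - 1) = 1\<close>.\<close>

lemma power_card_UNIV_eq_self:
  fixes x :: "'a :: {field, finite}"
  shows "x ^ card (UNIV :: 'a set) = x"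
proof (cases "x = 0")
  case True
  then show ?thesis
    by (simp add: power_0_left finite_UNIV_card_ge_0)
next
  case False
  let ?N = "card (UNIV :: 'a set)"
  let ?P = "\<Prod>y\<in>UNIV - {0 :: 'a}. y"
  have "bij_betw (\<lambda>y. x * y) (UNIV - {0}) (UNIV - {0})"
    by (rule bij_betwI[where g = "\<lambda>y. y / x"]) (use False in auto)
  then have "?P = (\<Prod>y\<in>UNIV - {0}. x * y)"
    by (rule prod.reindex_bij_betw[symmetric])
  also have "\<dots> = x ^ (?N - 1) * ?P"
    by (simp add: prod.distrib card_Diff_singleton)
  finally have "x ^ (?N - 1) * ?P = ?P" ..
  moreover have "?P \<noteq> 0"
    by simp
  ultimately have "x ^ (?N - 1) = 1"
    by (metis mult_cancel_right2)
  moreover have "?N = Suc (?N - 1)"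
    by (simp add: finite_UNIV_card_ge_0)
  ultimately show ?thesis
    by (metis mult.right_neutral power_Suc)
qed

text \<open>
  \<open>(X + 1)\<^sup>q - X\<^sup>q - 1\<close> has degree below \<open>q\<close> and vanishes on the whole field.
\<close>

lemma of_nat_card_UNIV_choose_eq_0:
  assumes "0 < j" "j < card (UNIV :: 'f :: {field, finite} set)"
  shows "of_nat (card (UNIV :: 'f set) choose j) = (0 :: 'f)"
proof -
  let ?q = "card (UNIV :: 'f set)"
  define p where "p = (\<Sum>i\<in>{1..<?q}. monom (of_nat (?q choose i) :: 'f) i)"
  have root: "poly p x = 0" for x
  proof -
    have "x + 1 = (x + 1) ^ ?q"
      by (simp add: power_card_UNIV_eq_self)
    also have "\<dots> = (\<Sum>i\<le>?q. of_nat (?q choose i) * x ^ i)"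
      by (subst binomial_ring) simp
    also have "{..?q} = insert 0 (insert ?q {1..<?q})"
      by auto
    also have "(\<Sum>i\<in>\<dots>. of_nat (?q choose i) * x ^ i) = 1 + (x + poly p x)"
      using finite_UNIV_card_ge_0[where 'a = 'f]
      by (simp add: p_def poly_sum poly_monom power_card_UNIV_eq_self)
    finally show ?thesis
      by simp
  qed
  have "degree p < ?q"
    unfolding p_def
    by (rule degree_sum_less) (use assms in \<open>auto intro: le_less_trans[OF degree_monom_le]\<close>)
  moreover have "?q \<le> degree p" if "p \<noteq> 0"
    using card_poly_roots_bound[OF that] by (simp add: root)
  ultimately have "p = 0"
    by fastforce
  then have "coeff p j = 0"
    by simp
  then show ?thesis
    using assms by (simp add: p_def coeff_sum)
qed

section \<open>The trace form\<close>

context finite_field_extension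
begin

abbreviation scaleF :: "'f \<Rightarrow> 'a \<Rightarrow> 'a" where
  "scaleF \<equiv> \<lambda>c x. \<iota> c * x"

sublocale Fq: vector_space scaleF
  by unfold_locales (simp_all add: algebra_simps hom_distribs)

text \<open>Extending the empty independent set names one fixed basis of the extension field, which
  is finite because the field is.\<close>

sublocale Fq: finite_dimensional_vector_space scaleF "Fq.extend_basis {}"
  by unfold_locales
    (simp_all add: Fq.independent_extend_basis Fq.span_extend_basis Fq.independent_empty)

text \<open>Pairing the extension with the base field gives access to linear functionals, in
  particular to their extension from independent sets.\<close>

sublocale functional: vector_space_pair scaleF "(*) :: 'f \<Rightarrow> 'f \<Rightarrow> 'f"
  by unfold_locales (simp_all add: algebra_simps)

section \<open>Field sizes and the \<open>q\<close>-power map\<close>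

lemma q_gt_1: "q > 1"
proof -
  have "card {0, 1 :: 'f} \<le> q"
    unfolding card_base[symmetric] by (rule card_mono) auto
  then show ?thesis
    by simp
qed

lemma m_pos: "m > 0"
proof (rule ccontr)
  assume "\<not> m > 0"
  then have "card (UNIV :: 'a set) = 1"
    using card_ext by simp
  moreover have "card {0, 1 :: 'a} \<le> card (UNIV :: 'a set)"
    by (rule card_mono) auto
  ultimately show False
    by simp
qed

text \<open>The inner binomial coefficients vanish in the base field, and \<iota> carries this over
  to the extension.\<close>

lemma power_q_add: "(x + y :: 'a) ^ q = x ^ q + y ^ q"
proof -
  have "of_nat (q choose j) = (0 :: 'a)" if "0 < j" "j < q" for j
  proof -
    have "of_nat (q choose j) = \<iota> (of_nat (q choose j))"
      by (simp add: hom_distribs)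
    then show ?thesis
      using of_nat_card_UNIV_choose_eq_0[where 'f = 'f, of j] that by (simp add: card_base)
  qed
  then have "(\<Sum>i\<in>{1..<q}. of_nat (q choose i) * x ^ i * y ^ (q - i)) = 0"
    by (intro sum.neutral) auto
  moreover have "{..q} = insert 0 (insert q {1..<q})"
    by auto
  ultimately show ?thesis
    using q_gt_1 by (simp add: binomial_ring add.commute)
qed

lemma power_q_power_add: "(x + y :: 'a) ^ (q ^ i) = x ^ (q ^ i) + y ^ (q ^ i)"
  by (induction i) (simp_all add: power_q_add power_mult mult.commute[of q])

lemma power_q_sum: "(sum f A :: 'a) ^ q = (\<Sum>i\<in>A. f i ^ q)"
  using q_gt_1 by (induction A rule: infinite_finite_induct) (simp_all add: power_q_add)

lemma hom_power_q: "\<iota> c ^ q = \<iota> c"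
  by (metis card_base hom_power power_card_UNIV_eq_self)

lemma hom_power_q_power: "\<iota> c ^ (q ^ i) = \<iota> c"
  by (induction i) (simp_all add: hom_power_q power_mult)

text \<open>The polynomial X^q - X has at most \<open>q\<close> roots, and the \<open>q\<close>
  elements of \<open>range \<iota>\<close> are already roots.\<close>

lemma power_q_eq_self_imp_range:
  assumes "(x :: 'a) ^ q = x"
  shows "x \<in> range \<iota>"
proof -
  define p where "p = monom (1 :: 'a) q - monom 1 1"
  have deg: "degree p \<le> q"
    unfolding p_def
    by (rule degree_diff_le) (use q_gt_1 in \<open>auto intro: order_trans[OF degree_monom_le]\<close>)
  have "coeff p q = 1"
    using q_gt_1 by (simp add: p_def)
  then have "p \<noteq> 0"
    by auto
  have roots: "{y. poly p y = 0} = {y. y ^ q = y}"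
    by (simp add: p_def poly_monom)
  have "range \<iota> \<subseteq> {y. y ^ q = y}"
    by (auto simp: hom_power_q)
  moreover have "card {y :: 'a. y ^ q = y} \<le> card (range \<iota>)"
    using card_poly_roots_bound[OF \<open>p \<noteq> 0\<close>] deg
    by (simp add: roots card_image[OF inj_f] card_base)
  ultimately show ?thesis
    using card_seteq[of "{y. y ^ q = y}" "range \<iota>"] assms by auto
qed

section \<open>The trace: linearity, values in the base field, nondegeneracy\<close>

abbreviation Tr :: "'a \<Rightarrow> 'a" where
  "Tr \<equiv> field_trace q m"

lemma Tr_add: "Tr (x + y) = Tr x + Tr y"
  by (simp add: field_trace_def power_q_power_add sum.distrib)

lemma Tr_hom_mult: "Tr (\<iota> c * x) = \<iota> c * Tr x"
  by (simp add: field_trace_def power_mult_distrib hom_power_q_power sum_distrib_left)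

lemma Tr_mult_hom: "Tr (a * (\<iota> c * x)) = \<iota> c * Tr (a * x)"
  by (simp only: mult.left_commute[of a] Tr_hom_mult)

lemma Tr_0: "Tr 0 = 0"
  using Tr_hom_mult[of 0 0] by simp

lemma Tr_diff: "Tr (x - y) = Tr x - Tr y"
  using Tr_add[of "x - y" y] by simp

text \<open>The \<open>q\<close>-power map shifts the summands of the trace cyclically: the new top
  term \<open>x ^ (q ^ m)\<close> equals the lost term \<open>x\<close>. Hence the trace is fixed by
  it.\<close>

lemma Tr_in_range: "Tr x \<in> range \<iota>"
proof (rule power_q_eq_self_imp_range)
  have "Tr x ^ q = (\<Sum>i<m. x ^ (q ^ Suc i))"
    unfolding field_trace_def power_q_sum
    by (simp add: power_mult[symmetric] mult.commute)
  also have "\<dots> = (\<Sum>i<Suc m. x ^ (q ^ i)) - x"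
    by (subst sum.lessThan_Suc_shift) simp
  also have "\<dots> = Tr x"
    using power_card_UNIV_eq_self[of x] by (simp add: field_trace_def card_ext)
  finally show "Tr x ^ q = Tr x" .
qed

text \<open>The trace is a nonzero polynomial function of degree below \<open>q\<^sup>m\<close>.\<close>

lemma Tr_nonzero: "\<exists>x. Tr x \<noteq> 0"
proof (rule ccontr)
  assume "\<not> ?thesis"
  define p where "p = (\<Sum>i<m. monom (1 :: 'a) (q ^ i))"
  have "poly p x = Tr x" for x
    by (simp add: p_def poly_sum poly_monom field_trace_def)
  with \<open>\<not> ?thesis\<close> have root: "poly p x = 0" for x
    by simp
  \<comment> \<open>Only the summand with exponent \<open>q ^ 0\<close> is linear, since
    \<open>q > 1\<close>.\<close>
  have "coeff p 1 = (\<Sum>i<m. if i = 0 then 1 else 0)"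
    unfolding p_def coeff_sum using q_gt_1 by (intro sum.cong) auto
  then have "p \<noteq> 0"
    using m_pos by auto
  have "q ^ m \<le> degree p"
    using card_poly_roots_bound[OF \<open>p \<noteq> 0\<close>] by (simp add: root card_ext)
  moreover have "degree p < q ^ m"
    unfolding p_def
    by (rule degree_sum_less)
      (use q_gt_1 in \<open>auto simp: degree_monom_eq intro: power_strict_increasing\<close>)
  ultimately show False
    by simp
qed

text \<open>For nonzero \<open>b\<close> the products \<open>b * y\<close> run through the whole
  field, on which the trace is not identically zero.\<close>

lemma Tr_form_nondegenerate:
  assumes "\<And>y. Tr (b * y) = 0"
  shows "b = 0"
proof (rule ccontr)
  assume "b \<noteq> 0"
  obtain x where "Tr x \<noteq> 0"
    using Tr_nonzero by blast
  then show False
    using assms[of "x / b"] \<open>b \<noteq> 0\<close> by simp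
qed

section \<open>Trace duals and double duality\<close>

lemma subspace_trace_dual: "Fq.subspace (trace_dual q m W)"
  by (auto simp: Fq.subspace_def trace_dual_def Tr_0 Tr_add Tr_mult_hom distrib_left)

text \<open>By symmetry of the form, \<open>x\<close> is orthogonal to \<open>S\<close> iff
  \<open>S\<close> lies in the dual of \<open>{x}\<close>; that dual is a subspace, so it then
  contains the span.\<close>

lemma trace_dual_span: "trace_dual q m (Fq.span S) = trace_dual q m S"
proof -
  have "x \<in> trace_dual q m (Fq.span S)" if "x \<in> trace_dual q m S" for x
  proof -
    have "S \<subseteq> trace_dual q m {x}"
      using that by (auto simp: trace_dual_def mult.commute)
    then have "Fq.span S \<subseteq> trace_dual q m {x}"
      by (rule Fq.span_minimal[OF _ subspace_trace_dual])
    then show ?thesis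
      by (auto simp: trace_dual_def mult.commute)
  qed
  moreover have "trace_dual q m (Fq.span S) \<subseteq> trace_dual q m S"
    using Fq.span_superset[of S] by (auto simp: trace_dual_def)
  ultimately show ?thesis
    by blast
qed

text \<open>
  By nondegeneracy \<open>b \<mapsto> Tr (b \<cdot>)\<close> is injective, and there are no more functionals than elements
  of the extension field.
\<close>

lemma functional_eq_Tr:
  assumes g: "Vector_Spaces.linear scaleF (*) g"
  shows "\<exists>b. \<forall>y. \<iota> (g y) = Tr (b * y)"
proof -
  interpret g: Vector_Spaces.linear scaleF "(*)" g
    by (fact g)
  let ?B = "Fq.extend_basis {}"
  \<comment> \<open>Functionals are represented by their value tuples on the basis. The restriction
    in \<Phi> fixes a default value off \<open>?B\<close>, as membership in \<open>?F\<close>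
    demands.\<close>
  let ?F = "?B \<rightarrow>\<^sub>E range \<iota>"
  define \<Phi> where "\<Phi> b = (\<lambda>y\<in>?B. Tr (b * y))" for b
  have \<Phi>_apply: "\<Phi> b y = Tr (b * y)" if "y \<in> ?B" for b y
    using that by (simp add: \<Phi>_def)
  \<comment> \<open>Agreement on the basis spreads to the whole field once the agreement set is a
    subspace. This serves both for injectivity of \<Phi> and for recovering \<open>g\<close> from
    its basis values.\<close>
  have agree: "h y = h' y"
    if "Fq.subspace {y. h y = h' y}" "\<And>y. y \<in> ?B \<Longrightarrow> h y = h' y" for h h' :: "'a \<Rightarrow> 'a" and y
  proof -
    have "Fq.span ?B \<subseteq> {y. h y = h' y}"
      by (rule Fq.span_minimal[OF _ that(1)]) (use that(2) in blast)
    then show ?thesis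
      by (simp only: Fq.span_Basis subset_iff UNIV_I mem_Collect_eq simp_thms)
  qed
  have "inj \<Phi>"
  proof (rule injI)
    fix b b' assume "\<Phi> b = \<Phi> b'"
    then have "Tr (b * y) = Tr (b' * y)" if "y \<in> ?B" for y
      using \<open>\<Phi> b = \<Phi> b'\<close> that by (metis \<Phi>_apply)
    then have "Tr (b * y) = Tr (b' * y)" for y
      by (rule agree[rotated])
        (auto simp: Fq.subspace_def Tr_add Tr_mult_hom distrib_left)
    then show "b = b'"
      using Tr_form_nondegenerate[of "b - b'"] by (simp add: left_diff_distrib Tr_diff)
  qed
  \<comment> \<open>Reading a value tuple as coordinates embeds \<open>?F\<close> into the extension
    field, which bounds its size.\<close>
  have "inj_on (\<lambda>f. \<Sum>v\<in>?B. f v * v) ?F"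
  proof (rule inj_onI)
    fix f f' assume ff: "f \<in> ?F" "f' \<in> ?F" and eq: "(\<Sum>v\<in>?B. f v * v) = (\<Sum>v\<in>?B. f' v * v)"
    \<comment> \<open>Linear independence speaks of coefficients in the base field, so the
      differences are pulled back along \<iota>.\<close>
    define c where "c v = inv_into UNIV \<iota> (f v - f' v)" for v
    have c: "\<iota> (c v) = f v - f' v" if "v \<in> ?B" for v
    proof -
      have "f v \<in> range \<iota>" "f' v \<in> range \<iota>"
        using PiE_mem[OF ff(1) that] PiE_mem[OF ff(2) that] by simp_all
      then obtain a a' where "f v = \<iota> a" "f' v = \<iota> a'"
        by blast
      then have "f v - f' v = \<iota> (a - a')"
        by (simp add: hom_distribs)
      then show ?thesis
        unfolding c_def by (simp add: f_inv_into_f)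
    qed
    have "(\<Sum>v\<in>?B. \<iota> (c v) * v) = 0"
      using eq by (simp add: c left_diff_distrib sum_subtractf)
    then have "\<forall>v\<in>?B. c v = 0"
      using Fq.independent_Basis Fq.independent_explicit by blast
    then have "f v = f' v" if "v \<in> ?B" for v
      using c that by fastforce
    then show "f = f'"
      using ff by (intro PiE_ext)
  qed
  then have "card ?F \<le> card (UNIV :: 'a set)"
    by (rule card_inj_on_le) auto
  also have "\<dots> = card (range \<Phi>)"
    using \<open>inj \<Phi>\<close> by (simp add: card_image)
  \<comment> \<open>An injective \<Phi> into a set no larger than its domain must be onto.\<close>
  finally have "range \<Phi> = ?F"
    by (intro card_seteq finite_PiE Fq.finite_Basis) (auto simp: \<Phi>_def intro: Tr_in_range)
  moreover have "(\<lambda>y\<in>?B. \<iota> (g y)) \<in> ?F"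
    by auto
  ultimately obtain b where b: "\<Phi> b = (\<lambda>y\<in>?B. \<iota> (g y))"
    by (metis (no_types, lifting) imageE)
  have "\<iota> (g y) = Tr (b * y)" if "y \<in> ?B" for y
    using fun_cong[OF b, of y] that by (simp add: \<Phi>_apply)
  then have "\<iota> (g y) = Tr (b * y)" for y
    by (rule agree[rotated])
      (auto simp: Fq.subspace_def Tr_0 Tr_add Tr_mult_hom distrib_left
        g.add g.scale g.zero hom_distribs)
  then show ?thesis
    by blast
qed

text \<open>A point \<open>x\<close> outside \<open>W\<close> is separated from \<open>W\<close> by
  a linear functional. Writing it as a trace against some \<open>b\<close> puts \<open>b\<close>
  into the dual of \<open>W\<close> while \<open>b\<close> is not orthogonal to
  \<open>x\<close>.\<close>

lemma trace_dual_trace_dual: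
  assumes "Fq.subspace W"
  shows "trace_dual q m (trace_dual q m W) = W"
proof
  show "W \<subseteq> trace_dual q m (trace_dual q m W)"
    by (auto simp: trace_dual_def mult.commute)
  show "trace_dual q m (trace_dual q m W) \<subseteq> W"
  proof (rule subsetI, rule ccontr)
    fix x assume x: "x \<in> trace_dual q m (trace_dual q m W)" and "x \<notin> W"
    obtain B where B: "B \<subseteq> W" "Fq.independent B" "W \<subseteq> Fq.span B"
      by (rule Fq.maximal_independent_subset)
    have span: "Fq.span B = W"
      using B assms Fq.span_minimal by blast
    have "Fq.independent (insert x B)"
      using B \<open>x \<notin> W\<close> by (simp add: Fq.independent_insertI span)
    \<comment> \<open>The separating functional is prescribed as 0 on the basis \<open>B\<close> of
      \<open>W\<close> and 1 at \<open>x\<close>.\<close>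
    from functional.linear_independent_extend[OF this, of "\<lambda>y. if y = x then 1 else 0"]
    obtain g where g: "Vector_Spaces.linear scaleF (*) g"
      and gB: "\<forall>y\<in>insert x B. g y = (if y = x then 1 else 0)"
      by blast
    interpret g: Vector_Spaces.linear scaleF "(*)" g
      by (fact g)
    obtain b where b: "\<And>y. \<iota> (g y) = Tr (b * y)"
      using functional_eq_Tr[OF g] by blast
    have "g y = 0" if "y \<in> W" for y
      by (rule g.eq_0_on_span[where b = B]) (use gB B \<open>x \<notin> W\<close> that in auto)
    then have "b \<in> trace_dual q m W"
      by (simp add: trace_dual_def mult.commute[of _ b] flip: b)
    then have "Tr (b * x) = 0"
      using x by (simp add: trace_dual_def)
    then show False
      using b[of x] gB by simp
  qed
qed

text \<open>It suffices to test \<xi> on the generators \<open>a * v\<close>. Regrouping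
  \<open>a * v * \<xi>\<close> as \<open>a * (\<xi> * v)\<close> turns the test into membership of
  \<open>\<xi> * v\<close> in the double dual of \<open>W\<close>.\<close>

lemma mem_trace_dual_product_space_iff:
  assumes "Fq.subspace W"
  shows "\<xi> \<in> trace_dual q m (product_space \<iota> (trace_dual q m W) V) \<longleftrightarrow> (\<forall>v\<in>V. \<xi> * v \<in> W)"
proof -
  have "\<xi> \<in> trace_dual q m (product_space \<iota> (trace_dual q m W) V) \<longleftrightarrow>
      (\<forall>v\<in>V. \<forall>a\<in>trace_dual q m W. Tr (a * v * \<xi>) = 0)"
    unfolding product_space_def Fq_span_def trace_dual_span by (auto simp: trace_dual_def)
  also have "\<dots> \<longleftrightarrow> (\<forall>v\<in>V. \<xi> * v \<in> trace_dual q m (trace_dual q m W))"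
    unfolding trace_dual_def[of q m "trace_dual q m W"] by (simp add: ac_simps)
  finally show ?thesis
    by (simp add: trace_dual_trace_dual assms)
qed

section \<open>Rank weights of block words\<close>

lemma span_mult_image: "Fq.span ((*) a ` S) = (*) a ` Fq.span S"
proof -
  interpret Vector_Spaces.linear scaleF scaleF "(*) a"
    by unfold_locales (simp_all add: algebra_simps)
  show ?thesis
    by (rule span_image)
qed

lemma dim_mult_image:
  assumes "a \<noteq> 0"
  shows "Fq.dim ((*) a ` S) = Fq.dim S"
proof -
  interpret pair: finite_dimensional_vector_space_pair scaleF "Fq.extend_basis {}"
    scaleF "Fq.extend_basis {}"
    by unfold_locales
  interpret Vector_Spaces.linear scaleF scaleF "(*) a"
    by unfold_locales (simp_all add: algebra_simps)
  show ?thesis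
    by (rule pair.dim_image_eq) (use assms in \<open>auto intro!: inj_onI linear_axioms\<close>)
qed

text \<open>The span of the union contains that of the block \<open>t\<close>, whose dimension is
  unchanged by the nonzero factor \<open>\<alpha> t\<close>. Equal dimensions therefore mean equal
  spans, and dividing by \<open>\<alpha> t\<close> normalizes the resulting inclusions.\<close>

lemma dim_Union_mult_image_eq_iff:
  assumes "t \<in> I" "\<alpha> t \<noteq> 0"
  shows "Fq.dim (\<Union>i\<in>I. (*) (\<alpha> i) ` S i) = Fq.dim (S t) \<longleftrightarrow>
    (\<forall>i\<in>I. \<forall>s\<in>Fq.span (S i). \<alpha> i / \<alpha> t * s \<in> Fq.span (S t))"
    (is "Fq.dim ?A = _ \<longleftrightarrow> _")
proof -
  let ?T = "(*) (\<alpha> t) ` S t"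
  have sub: "?T \<subseteq> ?A"
    using assms by blast
  have "Fq.dim ?A = Fq.dim (S t) \<longleftrightarrow> Fq.dim (Fq.span ?A) = Fq.dim (Fq.span ?T)"
    using assms by (simp add: dim_mult_image)
  also have "\<dots> \<longleftrightarrow> Fq.span ?T = Fq.span ?A"
  proof
    assume "Fq.dim (Fq.span ?A) = Fq.dim (Fq.span ?T)"
    then show "Fq.span ?T = Fq.span ?A"
      by (intro Fq.subspace_dim_equal[OF Fq.subspace_span Fq.subspace_span Fq.span_mono[OF sub]])
        (simp only: order_refl)
  qed (simp only:)
  also have "\<dots> \<longleftrightarrow> ?A \<subseteq> Fq.span ?T"
    using Fq.span_eq[of ?T ?A] order_trans[OF sub Fq.span_superset] by (simp only: simp_thms)
  also have "\<dots> \<longleftrightarrow> (\<forall>i\<in>I. (*) (\<alpha> i) ` S i \<subseteq> Fq.span ?T)"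
    by blast
  also have "\<dots> \<longleftrightarrow> (\<forall>i\<in>I. (*) (\<alpha> i) ` Fq.span (S i) \<subseteq> Fq.span ?T)"
  proof (intro ball_cong refl iffI)
    fix i assume "(*) (\<alpha> i) ` S i \<subseteq> Fq.span ?T"
    from Fq.span_minimal[OF this Fq.subspace_span]
    show "(*) (\<alpha> i) ` Fq.span (S i) \<subseteq> Fq.span ?T"
      by (simp only: span_mult_image)
  next
    fix i assume "(*) (\<alpha> i) ` Fq.span (S i) \<subseteq> Fq.span ?T"
    then show "(*) (\<alpha> i) ` S i \<subseteq> Fq.span ?T"
      using image_mono[OF Fq.span_superset] by (rule order_trans[rotated])
  qed
  also have "\<dots> \<longleftrightarrow> (\<forall>i\<in>I. \<forall>s\<in>Fq.span (S i). \<alpha> i / \<alpha> t * s \<in> Fq.span (S t))"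
  proof -
    have "\<alpha> i * s \<in> Fq.span ?T \<longleftrightarrow> \<alpha> i / \<alpha> t * s \<in> Fq.span (S t)" for i s
    proof -
      have "inj ((*) (\<alpha> t))"
        using assms by (auto intro: injI)
      moreover have "\<alpha> i * s = \<alpha> t * (\<alpha> i / \<alpha> t * s)"
        using assms by simp
      ultimately show ?thesis
        unfolding span_mult_image by (metis inj_image_mem_iff)
    qed
    then show ?thesis
      by (simp add: image_subset_iff)
  qed
  finally show ?thesis .
qed

lemma rank_weight_eq_dim: "rank_weight \<iota> v = Fq.dim (set\<^sub>v v)"
  by (simp add: rank_weight_def Fq_dim_def Fq_span_def)

end

section \<open>Concatenated blocks, block-diagonal generators and shortened codes\<close>

lemma vec_set_smult: "set\<^sub>v (a \<cdot>\<^sub>v v) = (*) a ` set\<^sub>v v"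
  by (auto simp: vec_set_def)

lemma vec_set_concat_blocks: "set\<^sub>v (concat_blocks k v) = (\<Union>i\<in>{1..k}. set\<^sub>v (v i))"
  unfolding set_list_of_vec[symmetric] concat_blocks_def
  by (auto simp: list_vec set_list_of_vec atLeastLessThanSuc_atLeastAtMost simp del: upt_Suc)

lemma concat_blocks_cong:
  assumes "\<And>i. i \<in> {1..k} \<Longrightarrow> v i = w i"
  shows "concat_blocks k v = concat_blocks k w"
  unfolding concat_blocks_def
  by (intro arg_cong[where f = "\<lambda>l. vec_of_list (concat l)"] map_cong) (auto simp: assms)

text \<open>Equal block lengths put the cuts at the same places in both words, so the blocks can be
  read off.\<close>

lemma concat_blocks_inject:
  assumes "concat_blocks k v = concat_blocks k w"
    and "\<And>i. i \<in> {1..k} \<Longrightarrow> dim_vec (v i) = dim_vec (w i)" and "i \<in> {1..k}"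
  shows "v i = w i"
proof -
  let ?l = "\<lambda>v. map (\<lambda>i. list_of_vec (v i)) [1..<Suc k]"
  have "concat (?l v) = concat (?l w)"
    using arg_cong[OF assms(1), of list_of_vec] by (simp add: concat_blocks_def list_vec del: upt_Suc)
  then have "?l v = ?l w"
    by (rule concat_injective) (use assms(2) in \<open>auto simp: set_zip simp del: upt_Suc\<close>)
  then have "list_of_vec (v i) = list_of_vec (w i)"
    using assms(3) unfolding map_eq_conv by (auto simp del: upt_Suc)
  then show ?thesis
    by (metis vec_list)
qed

lemma smult_concat_blocks: "a \<cdot>\<^sub>v concat_blocks k v = concat_blocks k (\<lambda>i. a \<cdot>\<^sub>v v i)"
proof -
  have smult: "a \<cdot>\<^sub>v vec_of_list l = vec_of_list (map ((*) a) l)" for l :: "'a list"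
    by (rule eq_vecI) (auto simp: vec_of_list_index)
  have "list_of_vec (a \<cdot>\<^sub>v w) = map ((*) a) (list_of_vec w)" for w :: "'a vec"
    by (metis list_vec smult vec_list)
  then show ?thesis
    by (simp add: concat_blocks_def smult map_concat comp_def del: upt_Suc)
qed

lemma vec_of_list_append: "vec_of_list (xs @ ys) = vec_of_list xs @\<^sub>v vec_of_list ys"
  by (metis list_of_vec_append list_vec vec_list)

lemma transpose_mat_of_row_mult_vec:
  "(mat_of_row w)\<^sup>T *\<^sub>v vec_of_list [a] = (a :: 'a :: field) \<cdot>\<^sub>v w"
  by (rule eq_vecI) (auto simp: mat_of_row_def scalar_prod_def)

text \<open>An arbitrary index list replaces \<open>[1..<Suc k]\<close> to allow induction: the
  first block splits off as a corner of a four-block matrix, whose zero blocks contribute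
  nothing.\<close>

lemma transpose_diag_block_mat_of_row_mult_vec:
  fixes u :: "nat \<Rightarrow> 'a :: field vec"
  shows "(diag_block_mat (map (\<lambda>i. mat_of_row (u i)) is))\<^sup>T *\<^sub>v vec_of_list (map \<alpha> is) =
    vec_of_list (concat (map (\<lambda>i. list_of_vec (\<alpha> i \<cdot>\<^sub>v u i)) is))"
proof (induction "is")
  case Nil
  show ?case
    by (rule eq_vecI) auto
next
  case (Cons i "is")
  define D where "D = diag_block_mat (map (\<lambda>i. mat_of_row (u i)) is)"
  let ?R = "mat_of_row (u i)"
  have dim: "dim_row D = length is"
    by (simp add: D_def dim_diag_block_mat comp_def sum_list_triv)
  have R: "?R \<in> carrier_mat 1 (dim_vec (u i))"
    by auto
  have D: "D \<in> carrier_mat (length is) (dim_col D)"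
    using dim by auto
  have "(diag_block_mat (map (\<lambda>i. mat_of_row (u i)) (i # is)))\<^sup>T =
      four_block_mat ?R\<^sup>T (0\<^sub>m (dim_vec (u i)) (length is)) (0\<^sub>m (dim_col D) 1) D\<^sup>T"
    using transpose_four_block_mat[OF R zero_carrier_mat zero_carrier_mat D]
    by (simp add: Let_def D_def[symmetric] dim)
  moreover have "vec_of_list (map \<alpha> (i # is)) = vec_of_list [\<alpha> i] @\<^sub>v vec_of_list (map \<alpha> is)"
    by (metis list.simps(9) append_Cons append_Nil vec_of_list_append)
  moreover have "four_block_mat ?R\<^sup>T (0\<^sub>m (dim_vec (u i)) (length is)) (0\<^sub>m (dim_col D) 1) D\<^sup>T
      *\<^sub>v (vec_of_list [\<alpha> i] @\<^sub>v vec_of_list (map \<alpha> is)) =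
      ?R\<^sup>T *\<^sub>v vec_of_list [\<alpha> i] @\<^sub>v D\<^sup>T *\<^sub>v vec_of_list (map \<alpha> is)"
  proof -
    have a: "vec_of_list [\<alpha> i] \<in> carrier_vec 1" "vec_of_list (map \<alpha> is) \<in> carrier_vec (length is)"
      by (rule carrier_vecI, simp)+
    have "D\<^sup>T *\<^sub>v vec_of_list (map \<alpha> is) \<in> carrier_vec (dim_col D)"
      "?R\<^sup>T *\<^sub>v vec_of_list [\<alpha> i] \<in> carrier_vec (dim_vec (u i))"
      by (rule carrier_vecI, simp)+
    moreover have "0\<^sub>m r c *\<^sub>v v = 0\<^sub>v r" if "v \<in> carrier_vec c" for r c and v :: "'a vec"
      by (rule eq_vecI) (use that in auto)
    ultimately show ?thesis
      unfolding four_block_mat_mult_vec[OF transpose_carrier_mat[THEN iffD2, OF R] zero_carrier_mat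
          zero_carrier_mat transpose_carrier_mat[THEN iffD2, OF D] a]
      by (simp only: a right_zero_vec left_zero_vec)
  qed
  ultimately show ?case
    using Cons.IH
    by (simp add: transpose_mat_of_row_mult_vec D_def[symmetric] vec_of_list_append vec_list
        del: vec_of_list_Cons)
qed

lemma concat_blocks_in_code:
  assumes "generator_matrix n k C G"
    and "G = diag_block_mat (map (\<lambda>i. mat_of_row (u i)) [1..<Suc k])"
  shows "concat_blocks k (\<lambda>i. \<alpha> i \<cdot>\<^sub>v u i) \<in> C"
proof -
  let ?x = "vec_of_list (map \<alpha> [1..<Suc k])"
  have "concat_blocks k (\<lambda>i. \<alpha> i \<cdot>\<^sub>v u i) = G\<^sup>T *\<^sub>v ?x"
    unfolding concat_blocks_def assms(2) transpose_diag_block_mat_of_row_mult_vec ..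
  moreover have "?x \<in> carrier_vec k"
    by (rule carrier_vecI) (simp del: upt_Suc)
  ultimately show ?thesis
    using assms(1) unfolding generator_matrix_def by blast
qed

text \<open>Shortened codes ask only for some coefficient family. As \<open>u t\<close> is nonzero,
  the word determines the coefficient at \<open>t\<close>, so a family with
  \<open>\<alpha> t \<noteq> 0\<close> rules out any other one witnessing membership in the next
  shortened code.\<close>

lemma mem_shortened_code_diff_iff:
  fixes u :: "nat \<Rightarrow> 'a :: field vec"
  assumes "\<And>\<alpha>. concat_blocks k (\<lambda>i. \<alpha> i \<cdot>\<^sub>v u i) \<in> C"
    and "t \<in> {1..k}" and "u t \<noteq> 0\<^sub>v (dim_vec (u t))"
  shows "c \<in> shortened_code k u C t - shortened_code k u C (t + 1) \<longleftrightarrow>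
    (\<exists>\<alpha>. (\<forall>i\<in>{1..<t}. \<alpha> i = 0) \<and> \<alpha> t \<noteq> 0 \<and> c = concat_blocks k (\<lambda>i. \<alpha> i \<cdot>\<^sub>v u i))"
    (is "?lhs \<longleftrightarrow> ?rhs")
proof
  assume ?lhs
  then obtain \<alpha> where \<alpha>: "\<forall>i\<in>{1..<t}. \<alpha> i = 0" "c = concat_blocks k (\<lambda>i. \<alpha> i \<cdot>\<^sub>v u i)"
    and "c \<in> C" "c \<notin> shortened_code k u C (t + 1)"
    by (auto simp: shortened_code_def)
  \<comment> \<open>Otherwise the same \<alpha> would witness membership in the next shortened
    code.\<close>
  then have "\<not> (\<forall>i\<in>{1..<t + 1}. \<alpha> i = 0)"
    unfolding shortened_code_def by blast
  with \<alpha> have "\<alpha> t \<noteq> 0"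
    by (auto simp: less_Suc_eq)
  with \<alpha> show ?rhs
    by blast
next
  assume ?rhs
  then obtain \<alpha> where \<alpha>: "\<forall>i\<in>{1..<t}. \<alpha> i = 0" "\<alpha> t \<noteq> 0"
    and c: "c = concat_blocks k (\<lambda>i. \<alpha> i \<cdot>\<^sub>v u i)"
    by blast
  have "c \<notin> shortened_code k u C (t + 1)"
  proof
    assume "c \<in> shortened_code k u C (t + 1)"
    then obtain \<gamma> where "\<forall>i\<in>{1..<t + 1}. \<gamma> i = 0" "c = concat_blocks k (\<lambda>i. \<gamma> i \<cdot>\<^sub>v u i)"
      by (auto simp: shortened_code_def)
    then have "\<gamma> t = 0" "\<alpha> t \<cdot>\<^sub>v u t = \<gamma> t \<cdot>\<^sub>v u t"
      using c assms(2) concat_blocks_inject[of k "\<lambda>i. \<alpha> i \<cdot>\<^sub>v u i" "\<lambda>i. \<gamma> i \<cdot>\<^sub>v u i" t] by auto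
    then have "u t $ j = 0" if "j < dim_vec (u t)" for j
      using that \<open>\<alpha> t \<noteq> 0\<close> by (metis index_smult_vec(1) mult_eq_0_iff)
    then have "u t = 0\<^sub>v (dim_vec (u t))"
      by (intro eq_vecI) auto
    then show False
      using assms(3) by simp
  qed
  moreover have "c \<in> shortened_code k u C t"
    using \<alpha> c assms(1) by (auto simp: shortened_code_def)
  ultimately show ?lhs
    by simp
qed

section \<open>The codewords of weight \<open>ns t\<close>\<close>

theorem lemma4p4:
  fixes \<iota> :: "'f :: {field, finite} \<Rightarrow> 'a :: {field, finite}"
    and q m n k t :: nat
    and ns :: "nat \<Rightarrow> nat"
    and C :: "'a vec set"
    and u :: "nat \<Rightarrow> 'a vec"
    and U :: "nat \<Rightarrow> 'a set"
    and G :: "'a mat"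
  assumes "finite_field_extension \<iota> q m"
    and "completely_decomposable \<iota> m n k ns C"
    and "generator_matrix n k C G"
    and "weight_complementary_form \<iota> k ns u G"
    and "\<And>i. i \<in> {1..k} \<Longrightarrow> U i = Fq_span \<iota> (set\<^sub>v (u i))"
    and "t \<in> {1..k - 1}"
  shows "{c \<in> shortened_code k u C t - shortened_code k u C (t + 1). rank_weight \<iota> c = ns t} =
    {\<beta> \<cdot>\<^sub>v concat_blocks k (\<lambda>i. if i < t then 0\<^sub>v (ns i) else if i = t then u t else \<xi> i \<cdot>\<^sub>v u i) | \<beta> \<xi>.
       \<beta> \<noteq> 0 \<and>
       (\<forall>h\<in>{t+1..k}. \<xi> h \<in> trace_dual q m (product_space \<iota> (trace_dual q m (U t)) (U h)))}"
    (is "?L = ?R")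
proof -
  interpret finite_field_extension \<iota> q m
    by (fact assms(1))
  let ?cw = "\<lambda>\<alpha>. concat_blocks k (\<lambda>i. \<alpha> i \<cdot>\<^sub>v u i)"
  let ?D = "\<lambda>h. trace_dual q m (product_space \<iota> (trace_dual q m (U t)) (U h))"
  have t: "t \<in> {1..k}"
    using assms(6) by auto
  have u: "u i \<in> carrier_vec (ns i)" "Fq.dim (set\<^sub>v (u i)) = ns i" if "i \<in> {1..k}" for i
    using assms(4) that by (auto simp: weight_complementary_form_def rank_weight_eq_dim)
  have U: "U i = Fq.span (set\<^sub>v (u i))" if "i \<in> {1..k}" for i
    using assms(5)[OF that] by (simp add: Fq_span_def)
  \<comment> \<open>A positive \<open>ns t\<close> excludes \<open>u t = 0\<close>, whose entries
    would span a space of dimension 0.\<close>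
  have "ns k \<le> ns t" "1 \<le> ns k"
    using assms(2) t by (auto simp: completely_decomposable_def monotone_on_def)
  then have "ns t \<noteq> 0"
    by simp
  have u_t: "u t \<noteq> 0\<^sub>v (dim_vec (u t))"
  proof
    assume "u t = 0\<^sub>v (dim_vec (u t))"
    then have "set\<^sub>v (u t) \<subseteq> {0}"
      by (metis image_subset_iff index_zero_vec insertI1 lessThan_iff vec_set_def)
    then have "Fq.dim (set\<^sub>v (u t)) = 0"
      by (simp only: Fq.dim_eq_0)
    then show False
      using u(2)[OF t] \<open>ns t \<noteq> 0\<close> by simp
  qed
  have "G = diag_block_mat (map (\<lambda>i. mat_of_row (u i)) [1..<Suc k])"
    using assms(4) by (simp add: weight_complementary_form_def)
  then have diff: "c \<in> shortened_code k u C t - shortened_code k u C (t + 1) \<longleftrightarrow>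
      (\<exists>\<alpha>. (\<forall>i\<in>{1..<t}. \<alpha> i = 0) \<and> \<alpha> t \<noteq> 0 \<and> c = ?cw \<alpha>)" for c
    by (intro mem_shortened_code_diff_iff concat_blocks_in_code[OF assms(3)] t u_t)
  have weight: "rank_weight \<iota> (?cw \<alpha>) = ns t \<longleftrightarrow> (\<forall>h\<in>{t+1..k}. \<alpha> h / \<alpha> t \<in> ?D h)"
    if \<alpha>: "\<forall>i\<in>{1..<t}. \<alpha> i = 0" "\<alpha> t \<noteq> 0" for \<alpha>
  proof -
    have "rank_weight \<iota> (?cw \<alpha>) = ns t \<longleftrightarrow>
        (\<forall>i\<in>{1..k}. \<forall>s\<in>Fq.span (set\<^sub>v (u i)). \<alpha> i / \<alpha> t * s \<in> Fq.span (set\<^sub>v (u t)))"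
      unfolding rank_weight_eq_dim vec_set_concat_blocks vec_set_smult u(2)[OF t, symmetric]
      by (rule dim_Union_mult_image_eq_iff) (use t \<alpha> in auto)
    also have "\<dots> \<longleftrightarrow> (\<forall>i\<in>{1..k}. \<forall>s\<in>U i. \<alpha> i / \<alpha> t * s \<in> U t)"
      using U t by simp
    also have "\<dots> \<longleftrightarrow> (\<forall>i\<in>{t+1..k}. \<forall>s\<in>U i. \<alpha> i / \<alpha> t * s \<in> U t)"
    proof -
      \<comment> \<open>Indices below \<open>t\<close> have ratio 0 and index \<open>t\<close> has
        ratio 1, so only the later blocks impose a condition.\<close>
      have "{1..k} = {1..<t} \<union> {t} \<union> {t+1..k}"
        using t by auto
      moreover have "0 \<in> U t"
        using U[OF t] by (simp add: Fq.span_zero)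
      ultimately show ?thesis
        using \<alpha> by auto
    qed
    also have "\<dots> \<longleftrightarrow> (\<forall>h\<in>{t+1..k}. \<alpha> h / \<alpha> t \<in> ?D h)"
      by (simp add: mem_trace_dual_product_space_iff U[OF t] Fq.subspace_span)
    finally show ?thesis .
  qed
  \<comment> \<open>The dictionary between the two parametrizations, used with
    \<open>\<xi> i = \<alpha> i / \<alpha> t\<close> for one inclusion and with \<alpha> built from
    \<beta> and \<xi> for the other.\<close>
  have word: "\<beta> \<cdot>\<^sub>v concat_blocks k (\<lambda>i. if i < t then 0\<^sub>v (ns i) else if i = t then u t else \<xi> i \<cdot>\<^sub>v u i)
      = ?cw \<alpha>"
    if "\<forall>i\<in>{1..<t}. \<alpha> i = 0" "\<alpha> t = \<beta>" "\<forall>i\<in>{t+1..k}. \<alpha> i = \<beta> * \<xi> i" for \<alpha> \<beta> \<xi>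
    unfolding smult_concat_blocks
  proof (rule concat_blocks_cong)
    fix i assume i: "i \<in> {1..k}"
    consider "i < t" | "i = t" | "i > t"
      by linarith
    then show "\<beta> \<cdot>\<^sub>v (if i < t then 0\<^sub>v (ns i) else if i = t then u t else \<xi> i \<cdot>\<^sub>v u i) = \<alpha> i \<cdot>\<^sub>v u i"
      by cases (use that i u(1)[OF i] in \<open>auto simp: smult_smult_assoc\<close>)
  qed
  show ?thesis
  proof (intro equalityI subsetI)
    fix c assume "c \<in> ?L"
    then obtain \<alpha> where \<alpha>: "\<forall>i\<in>{1..<t}. \<alpha> i = 0" "\<alpha> t \<noteq> 0" and c: "c = ?cw \<alpha>"
      and "rank_weight \<iota> c = ns t"
      using diff by blast
    then have "\<forall>h\<in>{t+1..k}. \<alpha> h / \<alpha> t \<in> ?D h"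
      using weight by simp
    moreover have "c = \<alpha> t \<cdot>\<^sub>v concat_blocks k
        (\<lambda>i. if i < t then 0\<^sub>v (ns i) else if i = t then u t else (\<alpha> i / \<alpha> t) \<cdot>\<^sub>v u i)"
      unfolding c by (rule word[symmetric]) (use \<alpha> in auto)
    ultimately show "c \<in> ?R"
      using \<alpha>(2) by (intro CollectI exI[of _ "\<alpha> t"] exI[of _ "\<lambda>i. \<alpha> i / \<alpha> t"] conjI)
  next
    fix c assume "c \<in> ?R"
    then obtain \<beta> \<xi> where "\<beta> \<noteq> 0" and \<xi>: "\<forall>h\<in>{t+1..k}. \<xi> h \<in> ?D h"
      and c: "c = \<beta> \<cdot>\<^sub>v concat_blocks k
        (\<lambda>i. if i < t then 0\<^sub>v (ns i) else if i = t then u t else \<xi> i \<cdot>\<^sub>v u i)"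
      by blast
    define \<alpha> where "\<alpha> i = (if i < t then 0 else if i = t then \<beta> else \<beta> * \<xi> i)" for i
    have \<alpha>: "\<forall>i\<in>{1..<t}. \<alpha> i = 0" "\<alpha> t \<noteq> 0"
      using \<open>\<beta> \<noteq> 0\<close> by (auto simp: \<alpha>_def)
    have "c = ?cw \<alpha>"
      unfolding c by (rule word) (auto simp: \<alpha>_def)
    moreover have "rank_weight \<iota> (?cw \<alpha>) = ns t"
      using \<xi> \<open>\<beta> \<noteq> 0\<close> by (subst weight[OF \<alpha>]) (auto simp: \<alpha>_def)
    ultimately show "c \<in> ?L"
      using diff[of c] \<alpha> by blast
  qed
qed

end
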